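(* Let $0<q\le1$, let $\alpha=\{\alpha_n\}_{n=0}^\infty$ be a bounded real sequence, and let $T_\alpha$ be the unilateral weighted shift operator on $H^2(\mathbb{D})$ given by $T_\alpha f=\sum_{n=0}^\infty\alpha_n\langle f,z^n\rangle z^{n+1}$. Then $\mathrm{Ber}_q(T_\alpha)$ is a disc centered at the origin, hence convex.
   Context: $\mathbb{D}$ is the open unit disc in $\mathbb{C}$. $H^2(\mathbb{D})$ is the Hardy space of analytic functions $\sum_{n\ge0}a_nz^n$ on $\mathbb{D}$ with $\sum|a_n|^2<\infty$ and inner product $\langle\sum a_nz^n,\sum b_nz^n\rangle=\sum a_n\overline{b_n}$. Its reproducing kernel at $w\in\mathbb{D}$ is $k_w(z)=\frac{1}{1-\overline{w}z}$, and $\hat{k}_w=k_w/\|k_w\|$. For a bounded linear operator $T$ on $H^2(\mathbb{D})$ and $0<q\le1$, the $q$-Berezin range is $\mathrm{Ber}_q(T)=\{\langle T\hat{k}_{w_1},\hat{k}_{w_2}\rangle: w_1,w_2\in\mathbb{D},\ \langle\hat{k}_{w_1},\hat{k}_{w_2}\rangle=q\}$. A disc centered at the origin may be open or closed, and the degenerate disc $\{0\}$ is allowed. *)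

theory Defs
  imports "HOL-Complex_Analysis.Complex_Analysis"
begin

text \<open>
  Elements of the Hardy space are represented by total functions on \<^typ>\<open>complex\<close> of which only the
  values on the open unit disc matter: Taylor coefficients, inner product and norm depend only on
  these values.
\<close>

abbreviation taylor_coeff :: "(complex \<Rightarrow> complex) \<Rightarrow> nat \<Rightarrow> complex" where
  "taylor_coeff f n \<equiv> fps_nth (fps_expansion f 0) n"

definition hardy_space :: "(complex \<Rightarrow> complex) set" where
  "hardy_space = {f. f holomorphic_on ball 0 1 \<and> summable (\<lambda>n. (norm (taylor_coeff f n))\<^sup>2)}"

definition hardy_inner :: "(complex \<Rightarrow> complex) \<Rightarrow> (complex \<Rightarrow> complex) \<Rightarrow> complex" where
  "hardy_inner f g = (\<Sum>n. taylor_coeff f n * cnj (taylor_coeff g n))"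

definition hardy_norm :: "(complex \<Rightarrow> complex) \<Rightarrow> real" where
  "hardy_norm f = sqrt (Re (hardy_inner f f))"

definition kernel :: "complex \<Rightarrow> complex \<Rightarrow> complex" where
  "kernel w = (\<lambda>z. 1 / (1 - cnj w * z))"

definition normalized_kernel :: "complex \<Rightarrow> complex \<Rightarrow> complex" where
  "normalized_kernel w = (\<lambda>z. kernel w z / complex_of_real (hardy_norm (kernel w)))"

definition q_berezin_range :: "real \<Rightarrow> ((complex \<Rightarrow> complex) \<Rightarrow> complex \<Rightarrow> complex) \<Rightarrow> complex set" where
  "q_berezin_range q T =
     {hardy_inner (T (normalized_kernel w1)) (normalized_kernel w2) | w1 w2.
        w1 \<in> ball 0 1 \<and> w2 \<in> ball 0 1 \<and>
        hardy_inner (normalized_kernel w1) (normalized_kernel w2) = complex_of_real q}"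

text \<open>
  The series is summed pointwise; \<open>weighted_shift_hardy\<close> below shows that on the Hardy space it also
  converges in norm, to the same function, and that the operator is bounded.
\<close>

definition weighted_shift :: "(nat \<Rightarrow> real) \<Rightarrow> (complex \<Rightarrow> complex) \<Rightarrow> complex \<Rightarrow> complex" where
  "weighted_shift \<alpha> f =
     (\<lambda>z. \<Sum>n. complex_of_real (\<alpha> n) * hardy_inner f (\<lambda>u. u ^ n) * z ^ (n + 1))"

text \<open>The degenerate disc \<open>{0}\<close> is the case \<open>R = 0\<close> of a closed disc.\<close>

definition disc_centered_at_origin :: "complex set \<Rightarrow> bool" where
  "disc_centered_at_origin S \<longleftrightarrow> (\<exists>R>0. S = ball 0 R) \<or> (\<exists>R\<ge>0. S = cball 0 R)"

lemma taylor_coeff_eqI: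
  assumes "\<And>z. norm z < 1 \<Longrightarrow> (\<lambda>n. c n * z ^ n) sums f z"
  shows "taylor_coeff f n = c n" "f holomorphic_on ball 0 1"
proof -
  have "eventually (\<lambda>z::complex. z \<in> ball 0 1) (nhds 0)"
    by (intro eventually_nhds_in_open) auto
  then have "f has_fps_expansion Abs_fps c"
    by (intro has_fps_expansionI) (auto elim!: eventually_mono intro!: assms)
  then show "taylor_coeff f n = c n"
    by (simp add: fps_expansion_eqI)
  show "f holomorphic_on ball 0 1"
    by (rule power_series_holomorphic[of 0 1 c]) (use assms in auto)
qed

lemma hardy_inner_monomial: "hardy_inner f (\<lambda>u. u ^ n) = taylor_coeff f n"
proof -
  have "fps_expansion (\<lambda>u. u ^ n) 0 = fps_X ^ n"
    by (intro fps_expansion_eqI fps_expansion_intros)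
  then have "hardy_inner f (\<lambda>u. u ^ n) = (\<Sum>k. if k = n then taylor_coeff f k else 0)"
    unfolding hardy_inner_def by (intro suminf_cong) auto
  also have "\<dots> = taylor_coeff f n"
    using sums_single[of n "taylor_coeff f"] by (simp add: sums_iff)
  finally show ?thesis .
qed

lemma hardy_norm_eq:
  assumes "summable (\<lambda>n. (norm (taylor_coeff f n))\<^sup>2)"
  shows "hardy_norm f = sqrt (\<Sum>n. (norm (taylor_coeff f n))\<^sup>2)"
proof -
  have "hardy_inner f f = (\<Sum>n. complex_of_real ((norm (taylor_coeff f n))\<^sup>2))"
    unfolding hardy_inner_def by (simp only: complex_norm_square)
  also have "\<dots> = complex_of_real (\<Sum>n. (norm (taylor_coeff f n))\<^sup>2)"
    by (rule suminf_of_real[symmetric, OF assms])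
  finally show ?thesis by (simp add: hardy_norm_def)
qed

lemma weighted_shift_hardy:
  assumes \<alpha>: "\<And>n. \<bar>\<alpha> n\<bar> \<le> C" and f: "f \<in> hardy_space"
  shows "weighted_shift \<alpha> f \<in> hardy_space"
    and "hardy_norm (weighted_shift \<alpha> f) \<le> C * hardy_norm f"
    and "(\<lambda>N. hardy_norm (\<lambda>z. weighted_shift \<alpha> f z -
            (\<Sum>n<N. complex_of_real (\<alpha> n) * hardy_inner f (\<lambda>u. u ^ n) * z ^ (n + 1)))) \<longlonglongrightarrow> 0"
proof -
  define a where "a = taylor_coeff f"
  define b where "b k = (case k of 0 \<Rightarrow> 0 | Suc n \<Rightarrow> complex_of_real (\<alpha> n) * a n)" for k
  have C: "C \<ge> 0" using \<alpha>[of 0] by linarith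
  have suma: "summable (\<lambda>n. (norm (a n))\<^sup>2)"
    using f by (simp add: hardy_space_def a_def)
  have le: "(norm (b (Suc n)))\<^sup>2 \<le> C\<^sup>2 * (norm (a n))\<^sup>2" for n
    using power_mono[OF \<alpha>[of n], of 2]
    by (auto simp: b_def norm_mult power_mult_distrib intro!: mult_right_mono)
  have sumb': "summable (\<lambda>n. (norm (b (Suc n)))\<^sup>2)"
    by (rule summable_comparison_test'[OF summable_mult[OF suma, of "C\<^sup>2"], of 0]) (use le in auto)
  then have sumb: "summable (\<lambda>n. (norm (b n))\<^sup>2)"
    by (subst (asm) summable_Suc_iff)
  have "(\<lambda>n. sqrt ((norm (b n))\<^sup>2)) \<longlonglongrightarrow> sqrt 0"
    by (intro tendsto_real_sqrt summable_LIMSEQ_zero sumb)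
  then have "Bseq b"
    by (intro convergent_imp_Bseq) (auto simp: convergent_def tendsto_norm_zero_iff)
  then obtain K where K: "\<And>n. norm (b n) \<le> K" by (auto simp: Bseq_def)
  have sums: "(\<lambda>n. b n * z ^ n) sums weighted_shift \<alpha> f z" if z: "norm z < 1" for z
  proof -
    have "summable (\<lambda>n. b n * z ^ n)"
      by (rule summable_comparison_test'[OF summable_mult[OF summable_geometric], of "norm z" 0 _ K])
        (use z K in \<open>auto simp: norm_mult norm_power intro!: mult_right_mono\<close>)
    then have "summable (\<lambda>n. b (Suc n) * z ^ Suc n)"
      by (subst summable_Suc_iff)
    then have "(\<lambda>n. b (Suc n) * z ^ Suc n) sums weighted_shift \<alpha> f z"
      unfolding weighted_shift_def hardy_inner_monomial
      by (simp add: b_def a_def sums_iff)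
    then show ?thesis
      by (subst (asm) sums_Suc_iff) (simp add: b_def)
  qed
  have coeff: "taylor_coeff (weighted_shift \<alpha> f) = b"
    by (rule ext) (rule taylor_coeff_eqI[OF sums])
  show "weighted_shift \<alpha> f \<in> hardy_space"
    using sumb taylor_coeff_eqI(2)[OF sums] by (simp add: hardy_space_def coeff)
  have "(\<Sum>n. (norm (b n))\<^sup>2) = (\<Sum>n. (norm (b (Suc n)))\<^sup>2)"
    using suminf_split_head[OF sumb] by (simp add: b_def)
  also have "\<dots> \<le> (\<Sum>n. C\<^sup>2 * (norm (a n))\<^sup>2)"
    by (intro suminf_le le sumb' summable_mult suma)
  also have "\<dots> = C\<^sup>2 * (\<Sum>n. (norm (a n))\<^sup>2)"
    by (intro suminf_mult suma)
  finally have "sqrt (\<Sum>n. (norm (b n))\<^sup>2) \<le> sqrt (C\<^sup>2 * (\<Sum>n. (norm (a n))\<^sup>2))"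
    by (rule real_sqrt_le_mono)
  then show "hardy_norm (weighted_shift \<alpha> f) \<le> C * hardy_norm f"
    using hardy_norm_eq[of "weighted_shift \<alpha> f"] hardy_norm_eq[of f] sumb suma C
    by (simp add: coeff a_def real_sqrt_mult)
  define D where "D N = (\<lambda>z. weighted_shift \<alpha> f z -
     (\<Sum>n<N. complex_of_real (\<alpha> n) * hardy_inner f (\<lambda>u. u ^ n) * z ^ (n + 1)))" for N
  have "hardy_norm (D N) = sqrt (\<Sum>n. (norm (b (n + Suc N)))\<^sup>2)" for N
  proof -
    define c where "c k = (if k < Suc N then 0 else b k)" for k
    have "(\<lambda>n. c n * z ^ n) sums D N z" if z: "norm z < 1" for z
    proof -
      have "(\<lambda>n. if n \<in> {..<Suc N} then b n * z ^ n else 0) sums (\<Sum>n<Suc N. b n * z ^ n)"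
        by (rule sums_If_finite_set) auto
      from sums_diff[OF sums[OF z] this]
      have "(\<lambda>n. c n * z ^ n) sums (weighted_shift \<alpha> f z - (\<Sum>n<Suc N. b n * z ^ n))"
        by (rule back_subst[of "\<lambda>h. h sums _"]) (auto simp: c_def)
      then show ?thesis
        by (simp add: D_def hardy_inner_monomial sum.lessThan_Suc_shift b_def a_def del: sum.lessThan_Suc)
    qed
    then have cD: "taylor_coeff (D N) = c"
      by (intro ext taylor_coeff_eqI(1))
    have eq: "(\<lambda>n. (norm (c (n + Suc N)))\<^sup>2) = (\<lambda>n. (norm (b (n + Suc N)))\<^sup>2)"
      by (auto simp: c_def)
    have "summable (\<lambda>n. (norm (c (n + Suc N)))\<^sup>2)"
      unfolding eq by (rule summable_ignore_initial_segment[OF sumb])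
    then have sumc: "summable (\<lambda>n. (norm (c n))\<^sup>2)"
      by (subst (asm) summable_iff_shift)
    have "(\<Sum>n. (norm (c n))\<^sup>2) = (\<Sum>n. (norm (b (n + Suc N)))\<^sup>2)"
      using suminf_split_initial_segment[OF sumc, of "Suc N"] unfolding eq by (simp add: c_def)
    then show ?thesis
      using hardy_norm_eq[of "D N"] sumc by (simp add: cD)
  qed
  moreover have "(\<lambda>N. \<Sum>n. (norm (b (n + N)))\<^sup>2) \<longlonglongrightarrow> 0"
    using suminf_exist_split2[OF sumb] by simp
  then have "(\<lambda>N. sqrt (\<Sum>n. (norm (b (n + Suc N)))\<^sup>2)) \<longlonglongrightarrow> sqrt 0"
    by (intro tendsto_real_sqrt) (rule LIMSEQ_Suc)
  ultimately show "(\<lambda>N. hardy_norm (\<lambda>z. weighted_shift \<alpha> f z -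
            (\<Sum>n<N. complex_of_real (\<alpha> n) * hardy_inner f (\<lambda>u. u ^ n) * z ^ (n + 1)))) \<longlonglongrightarrow> 0"
    by (simp add: D_def)
qed

lemma kernel_in_hardy_space:
  assumes "w \<in> ball 0 1"
  shows "kernel w \<in> hardy_space" "taylor_coeff (kernel w) n = cnj w ^ n"
proof -
  have s: "(\<lambda>n. cnj w ^ n * z ^ n) sums kernel w z" if "norm z < 1" for z
  proof -
    have "norm (cnj w * z) < 1"
      using assms that mult_strict_mono'[of "norm w" 1 "norm z" 1] by (simp add: norm_mult)
    from geometric_sums[OF this] show ?thesis
      by (simp add: kernel_def power_mult_distrib)
  qed
  show coeff: "taylor_coeff (kernel w) n = cnj w ^ n" for n
    by (rule taylor_coeff_eqI[OF s])
  have "(norm w)\<^sup>2 < 1"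
    using assms by (simp add: power_less_one_iff)
  then have "summable (\<lambda>n. ((norm w)\<^sup>2) ^ n)"
    by (intro summable_geometric) simp
  then show "kernel w \<in> hardy_space"
    using taylor_coeff_eqI(2)[OF s]
    by (simp add: hardy_space_def coeff norm_power mult.commute flip: power_mult)
qed

end

theory Submission
  imports Defs
begin

text \<open>
  Put \<open>p = sqrt (1 - q\<^sup>2)\<close>. The constraint forces \<open>cnj w\<^sub>1 * w\<^sub>2 = x\<close> to be real, and then the value of
  the form is \<open>q * w\<^sub>2 * (1 - x) * (\<Sum>n. \<alpha> n * x ^ n)\<close>. Rotating \<open>w\<^sub>1\<close> and \<open>w\<^sub>2\<close> simultaneously rotates
  this value, so the range is a union of circles. On real pairs \<open>(u, r)\<close> the constraint says that \<open>u\<close> is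
  the image of \<open>r\<close> under one of the Moebius maps \<open>r \<mapsto> (r \<plusminus> p) / (1 \<plusminus> r * p)\<close>, and \<open>r \<mapsto> -r\<close> swaps
  the two. The radii of the circles are thus the values of one bounded continuous function of
  \<open>r \<in> (-1, 1)\<close> that vanishes at \<open>0\<close>; they form an interval starting at \<open>0\<close>.
\<close>

section \<open>From an interval of radii to a disc\<close>

text \<open>A connected set through \<open>0\<close> contains every number from \<open>0\<close> up
  to its supremum, so only attainment of the supremum decides between the closed and the open disc.
  Negative members of \<open>M\<close> are never norms.\<close>

lemma disc_centered_at_origin_norm_mem:
  fixes M :: "real set"
  assumes conn: "connected M" and zero: "0 \<in> M" and bdd: "bdd_above M"
  shows "disc_centered_at_origin {z. norm z \<in> M}"
proof -
  define R where "R = Sup M"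
  have R0: "0 \<le> R" unfolding R_def by (rule cSup_upper[OF zero bdd])
  have upper: "m \<le> R" if "m \<in> M" for m unfolding R_def by (rule cSup_upper[OF that bdd])
  have lower: "y \<in> M" if y: "0 \<le> y" "y < R" for y
  proof -
    obtain m where "m \<in> M" "y < m"
      using less_cSupD[of M y] y zero by (auto simp: R_def)
    then show ?thesis using connectedD_interval[OF conn zero, of m y] y by auto
  qed
  show ?thesis
  proof (cases "R \<in> M")
    case True
    have "{z. norm z \<in> M} = cball 0 R"
      using upper lower True by (auto simp: order_le_less)
    then show ?thesis using R0 by (auto simp: disc_centered_at_origin_def)
  next
    case False
    have "{z. norm z \<in> M} = ball 0 R"
      using upper lower False by (auto simp: order_less_le)
    \<comment> \<open>An unattained supremum cannot be \<open>0\<close>, which lies in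
      \<open>M\<close>; the degenerate disc thus falls under the closed case.\<close>
    moreover have "0 < R" using R0 zero False by (cases "R = 0") auto
    ultimately show ?thesis by (auto simp: disc_centered_at_origin_def)
  qed
qed

lemma convex_disc_centered_at_origin: "disc_centered_at_origin S \<Longrightarrow> convex S"
  by (auto simp: disc_centered_at_origin_def)

section \<open>Taylor coefficients and inner products of kernels and their shifts\<close>

lemma hardy_norm_kernel:
  assumes "norm w < 1"
  shows "hardy_norm (kernel w) = 1 / sqrt (1 - (norm w)\<^sup>2)"
proof -
  have w: "w \<in> ball 0 1" using assms by simp
  have lt: "(norm w)\<^sup>2 < 1" using assms by (simp add: power_less_one_iff)
  have eq: "(norm (taylor_coeff (kernel w) n))\<^sup>2 = ((norm w)\<^sup>2) ^ n" for n
    by (simp add: kernel_in_hardy_space(2)[OF w] norm_power mult.commute flip: power_mult)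
  have "hardy_norm (kernel w) = sqrt (\<Sum>n. (norm (taylor_coeff (kernel w) n))\<^sup>2)"
    using kernel_in_hardy_space(1)[OF w] by (intro hardy_norm_eq) (simp add: hardy_space_def)
  also have "\<dots> = sqrt (1 / (1 - (norm w)\<^sup>2))"
    unfolding eq using lt by (subst suminf_geometric) auto
  finally show ?thesis by (simp add: real_sqrt_divide)
qed

lemma taylor_coeff_normalized_kernel:
  assumes "norm w < 1"
  shows "taylor_coeff (normalized_kernel w) n = sqrt (1 - (norm w)\<^sup>2) * cnj w ^ n"
proof (rule taylor_coeff_eqI(1))
  fix z :: complex assume "norm z < 1"
  then have "norm (cnj w * z) < 1"
    using assms mult_strict_mono'[of "norm w" 1 "norm z" 1] by (simp add: norm_mult)
  from sums_mult[OF geometric_sums[OF this], of "complex_of_real (sqrt (1 - (norm w)\<^sup>2))"]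
  show "(\<lambda>n. complex_of_real (sqrt (1 - (norm w)\<^sup>2)) * cnj w ^ n * z ^ n) sums normalized_kernel w z"
    unfolding normalized_kernel_def hardy_norm_kernel[OF assms]
    by (simp add: kernel_def power_mult_distrib mult.assoc)
qed

text \<open>The coefficient products form a geometric series in \<open>cnj w * v\<close>. Since the
  numerator is real, requiring the value \<open>q\<close> makes \<open>cnj w * v\<close>
  real.\<close>

lemma hardy_inner_normalized_kernels:
  fixes w v :: complex
  assumes "norm w < 1" "norm v < 1"
  shows "hardy_inner (normalized_kernel w) (normalized_kernel v) =
    sqrt (1 - (norm w)\<^sup>2) * sqrt (1 - (norm v)\<^sup>2) / (1 - cnj w * v)"
proof -
  have lt: "norm (cnj w * v) < 1"
    using assms mult_strict_mono'[of "norm w" 1 "norm v" 1] by (simp add: norm_mult)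
  have "hardy_inner (normalized_kernel w) (normalized_kernel v) =
     (\<Sum>n. complex_of_real (sqrt (1 - (norm w)\<^sup>2) * sqrt (1 - (norm v)\<^sup>2)) * (cnj w * v) ^ n)"
    unfolding hardy_inner_def
    by (intro suminf_cong) (simp add: taylor_coeff_normalized_kernel assms power_mult_distrib)
  also have "\<dots> = complex_of_real (sqrt (1 - (norm w)\<^sup>2) * sqrt (1 - (norm v)\<^sup>2)) * (1 / (1 - cnj w * v))"
    using sums_mult[OF geometric_sums[OF lt]] by (intro sums_unique[symmetric])
  finally show ?thesis by simp
qed

lemma summable_bounded_power_series:
  fixes a :: "nat \<Rightarrow> 'a :: {real_normed_field, banach}"
  assumes "\<And>n. norm (a n) \<le> C" "norm z < 1"
  shows "summable (\<lambda>n. a n * z ^ n)"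
proof (rule summable_comparison_test'[of "\<lambda>n. C * norm z ^ n" 0])
  show "summable (\<lambda>n. C * norm z ^ n)"
    using assms(2) by (intro summable_mult summable_geometric) simp
qed (auto simp: norm_mult norm_power intro!: mult_right_mono assms)

lemma taylor_coeff_weighted_shift:
  assumes \<alpha>: "\<And>n. \<bar>\<alpha> n\<bar> \<le> C" and f: "\<And>n. norm (taylor_coeff f n) \<le> K"
  shows "taylor_coeff (weighted_shift \<alpha> f) 0 = 0"
    and "taylor_coeff (weighted_shift \<alpha> f) (Suc n) = \<alpha> n * taylor_coeff f n"
proof -
  \<comment> \<open>The entry at index \<open>0\<close> records that the image has no constant term;
    all coefficients move up by one index.\<close>
  define b where "b k = (case k of 0 \<Rightarrow> 0 | Suc n \<Rightarrow> complex_of_real (\<alpha> n) * taylor_coeff f n)" for k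
  have C: "0 \<le> C" using \<alpha>[of 0] by linarith
  have "(\<lambda>n. b n * z ^ n) sums weighted_shift \<alpha> f z" if "norm z < 1" for z
  proof -
    have "norm (complex_of_real (\<alpha> n) * taylor_coeff f n) \<le> C * K" for n
      unfolding norm_mult using \<alpha> f C by (intro mult_mono) auto
    from summable_mult[OF summable_bounded_power_series[OF this that], of z]
    have "(\<lambda>n. b (Suc n) * z ^ Suc n) sums weighted_shift \<alpha> f z"
      unfolding weighted_shift_def hardy_inner_monomial
      by (simp add: b_def sums_iff algebra_simps)
    then show ?thesis
      by (subst (asm) sums_Suc_iff) (simp add: b_def)
  qed
  from taylor_coeff_eqI(1)[OF this]
  show "taylor_coeff (weighted_shift \<alpha> f) 0 = 0"
    "taylor_coeff (weighted_shift \<alpha> f) (Suc n) = \<alpha> n * taylor_coeff f n"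
    by (simp_all add: b_def)
qed

text \<open>Coefficient \<open>n\<close> of the first kernel meets coefficient \<open>n + 1\<close>
  of the second, which leaves one factor \<open>v\<close> in front of a series in
  \<open>cnj w * v\<close>.\<close>

lemma hardy_inner_weighted_shift_normalized_kernels:
  fixes w v :: complex
  assumes \<alpha>: "\<And>n. \<bar>\<alpha> n\<bar> \<le> C" and w: "norm w < 1" and v: "norm v < 1"
  shows "hardy_inner (weighted_shift \<alpha> (normalized_kernel w)) (normalized_kernel v) =
    sqrt (1 - (norm w)\<^sup>2) * sqrt (1 - (norm v)\<^sup>2) * v * (\<Sum>n. \<alpha> n * (cnj w * v) ^ n)"
proof -
  define c where "c = complex_of_real (sqrt (1 - (norm w)\<^sup>2)) * sqrt (1 - (norm v)\<^sup>2) * v"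
  define h where "h n = taylor_coeff (weighted_shift \<alpha> (normalized_kernel w)) n *
      cnj (taylor_coeff (normalized_kernel v) n)" for n
  have "(norm w)\<^sup>2 \<le> 1" using w by (simp add: power_le_one)
  then have "norm (taylor_coeff (normalized_kernel w) n) \<le> 1" for n
    unfolding taylor_coeff_normalized_kernel[OF w] norm_mult norm_power
    using w by (intro mult_le_one) (auto simp: power_le_one)
  note coeff = taylor_coeff_weighted_shift[of \<alpha>, OF \<alpha> this]
  have Suc: "h (Suc n) = c * (\<alpha> n * (cnj w * v) ^ n)" for n
    by (simp add: h_def c_def coeff taylor_coeff_normalized_kernel w v power_mult_distrib)
  have lt: "norm (cnj w * v) < 1"
    using w v mult_strict_mono'[of "norm w" 1 "norm v" 1] by (simp add: norm_mult)
  have "summable (\<lambda>n. complex_of_real (\<alpha> n) * (cnj w * v) ^ n)"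
    using lt by (intro summable_bounded_power_series[of _ C]) (auto simp: \<alpha>)
  from sums_mult[OF summable_sums[OF this], of c]
  have "(\<lambda>n. h (Suc n)) sums (c * (\<Sum>n. complex_of_real (\<alpha> n) * (cnj w * v) ^ n))"
    unfolding Suc .
  then have "h sums (c * (\<Sum>n. complex_of_real (\<alpha> n) * (cnj w * v) ^ n))"
    by (subst (asm) sums_Suc_iff) (simp add: h_def coeff)
  from sums_unique[OF this] show ?thesis
    unfolding hardy_inner_def h_def c_def by simp
qed

section \<open>Real power series with bounded coefficients\<close>

text \<open>Needed to bound the radii: the growth near \<open>\<bar>x\<bar> = 1\<close> is cancelled
  by the factor \<open>q * (1 - x)\<close>, which the constraint keeps below
  \<open>1 - \<bar>x\<bar>\<close>.\<close>

lemma abs_power_series_le: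
  fixes x :: real
  assumes \<alpha>: "\<And>n. \<bar>\<alpha> n\<bar> \<le> C" and x: "\<bar>x\<bar> < 1"
  shows "\<bar>\<Sum>n. \<alpha> n * x ^ n\<bar> \<le> C / (1 - \<bar>x\<bar>)"
proof -
  have "norm (\<Sum>n. \<alpha> n * x ^ n) \<le> (\<Sum>n. C * \<bar>x\<bar> ^ n)"
    using x by (intro norm_suminf_le summable_mult summable_geometric)
      (auto simp: abs_mult power_abs intro!: mult_right_mono \<alpha>)
  also have "\<dots> = C / (1 - \<bar>x\<bar>)"
    using x suminf_mult[of "\<lambda>n. \<bar>x\<bar> ^ n" C] suminf_geometric[of "\<bar>x\<bar>"] by simp
  finally show ?thesis by simp
qed

lemma continuous_on_bounded_power_series:
  fixes \<alpha> :: "nat \<Rightarrow> real"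
  assumes "\<And>n. \<bar>\<alpha> n\<bar> \<le> C"
  shows "continuous_on {-1<..<1} (\<lambda>x. \<Sum>n. \<alpha> n * x ^ n)"
proof (intro continuous_at_imp_continuous_on ballI)
  fix x :: real assume "x \<in> {-1<..<1}"
  then have "\<bar>x\<bar> < 1" by auto
  then obtain K where "\<bar>x\<bar> < K" "K < 1" using dense by blast
  then show "isCont (\<lambda>x. \<Sum>n. \<alpha> n * x ^ n) x"
    using assms by (intro isCont_powser[of _ K] summable_bounded_power_series[of _ C]) auto
qed

section \<open>The constraint on real pairs\<close>

text \<open>The third equation is the squared constraint for the pair \<open>(u, r)\<close>. The
  first two supply the signs that undo the squaring: for \<open>q > 0\<close>,
  \<open>\<bar>r\<bar> < 1\<close> and \<open>1 + r * p > 0\<close> they give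
  \<open>\<bar>u\<bar> < 1\<close> and \<open>u * r < 1\<close>.\<close>

lemma moebius_constraint:
  fixes p q r :: real
  assumes "q\<^sup>2 = 1 - p\<^sup>2" "1 + r * p \<noteq> 0"
  defines "u \<equiv> (r + p) / (1 + r * p)"
  shows "1 - u\<^sup>2 = q\<^sup>2 * (1 - r\<^sup>2) / (1 + r * p)\<^sup>2"
    and "1 - u * r = (1 - r\<^sup>2) / (1 + r * p)"
    and "(1 - u\<^sup>2) * (1 - r\<^sup>2) = (q * (1 - u * r))\<^sup>2"
proof -
  show 1: "1 - u\<^sup>2 = q\<^sup>2 * (1 - r\<^sup>2) / (1 + r * p)\<^sup>2"
    using assms(2) by (simp add: u_def assms(1) field_simps) (simp add: power2_eq_square algebra_simps)
  show 2: "1 - u * r = (1 - r\<^sup>2) / (1 + r * p)"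
    using assms(2) by (simp add: u_def field_simps power2_eq_square)
  show "(1 - u\<^sup>2) * (1 - r\<^sup>2) = (q * (1 - u * r))\<^sup>2"
    unfolding 1 2 by (simp add: power_mult_distrib power_divide power2_eq_square)
qed

text \<open>The constraint amounts to \<open>(u - r)\<^sup>2 = (p * (1 - u * r))\<^sup>2\<close>;
  for \<open>\<bar>u\<bar> < 1\<close> this says that \<open>u\<close> and \<open>r\<close> have
  pseudo-hyperbolic distance \<open>\<bar>p\<bar>\<close>. Each sign of the root leaves an equation
  linear in \<open>u\<close>.\<close>

lemma constraint_imp_moebius:
  fixes p q r u :: real
  assumes "q\<^sup>2 = 1 - p\<^sup>2" "\<bar>p\<bar> < 1" "\<bar>r\<bar> < 1" "(1 - u\<^sup>2) * (1 - r\<^sup>2) = (q * (1 - u * r))\<^sup>2"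
  shows "u = (r + p) / (1 + r * p) \<or> u = (r - p) / (1 - r * p)"
proof -
  have "\<bar>r * p\<bar> < 1"
    using mult_strict_mono'[of "\<bar>r\<bar>" 1 "\<bar>p\<bar>" 1] assms by (simp add: abs_mult)
  then have pos: "1 + r * p > 0" "1 - r * p > 0" by auto
  have "(u - r)\<^sup>2 = (1 - u * r)\<^sup>2 - (1 - u\<^sup>2) * (1 - r\<^sup>2)" by algebra
  also have "\<dots> = (p * (1 - u * r))\<^sup>2" unfolding assms(4) using assms(1) by algebra
  finally have "u - r = p * (1 - u * r) \<or> u - r = - (p * (1 - u * r))"
    by (simp add: power2_eq_iff)
  then show ?thesis using pos by (simp add: field_simps)
qed

section \<open>The radius function and the range\<close>

text \<open>\<open>x r\<close> is the product \<open>cnj w * v\<close> for the real pair that the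
  Moebius map with \<open>+p\<close> attaches to \<open>v = r\<close>, and \<open>g r\<close> is the
  modulus of the form there.\<close>

lemma q_berezin_range_weighted_shift:
  fixes q :: real and \<alpha> :: "nat \<Rightarrow> real"
  assumes q: "0 < q" "q \<le> 1" and \<alpha>: "\<And>n. \<bar>\<alpha> n\<bar> \<le> C"
  defines "p \<equiv> sqrt (1 - q\<^sup>2)"
  defines "x \<equiv> \<lambda>r. (r + p) / (1 + r * p) * r"
  defines "g \<equiv> \<lambda>r. \<bar>q * (1 - x r) * r * (\<Sum>n. \<alpha> n * x r ^ n)\<bar>"
  shows "q_berezin_range q (weighted_shift \<alpha>) = {z. norm z \<in> g ` {-1<..<1}}" (is "?B = ?D")
    and "continuous_on {-1<..<1} g"
    and "r \<in> {-1<..<1} \<Longrightarrow> g r \<le> C"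
proof -
  define A where "A y = (\<Sum>n. \<alpha> n * y ^ n)" for y
  define u where "u r = (r + p) / (1 + r * p)" for r
  have g: "g r = \<bar>q * (1 - x r) * r * A (x r)\<bar>" for r by (simp add: g_def A_def)
  have xu: "x r = u r * r" for r by (simp add: x_def u_def)
  have qp: "q\<^sup>2 = 1 - p\<^sup>2" using q by (simp add: p_def power_le_one)
  have p: "0 \<le> p" "p < 1" using q by (simp_all add: p_def power_le_one)
  have pos: "1 + r * p > 0" if "r \<in> {-1<..<1}" for r
  \<comment> \<open>Positivity of \<open>q\<close> gives \<open>p < 1\<close>, which keeps the
    Moebius denominator away from zero.\<close>
  proof -
    have "\<bar>r\<bar> * p < 1" using mult_strict_mono'[of "\<bar>r\<bar>" 1 p 1] p that by (auto simp: abs_less_iff)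
    moreover have "\<bar>r * p\<bar> = \<bar>r\<bar> * p" using p by (simp add: abs_mult)
    ultimately show ?thesis by linarith
  qed
  have r2: "1 - r\<^sup>2 > 0" if "r \<in> {-1<..<1}" for r :: real
    using that by (simp add: abs_square_less_1 abs_less_iff)
  have u: "\<bar>u r\<bar> < 1" "0 < 1 - u r * r" "(1 - (u r)\<^sup>2) * (1 - r\<^sup>2) = (q * (1 - u r * r))\<^sup>2"
    if r: "r \<in> {-1<..<1}" for r
  proof -
    note m = moebius_constraint[OF qp, of r, folded u_def]
    have "1 - (u r)\<^sup>2 > 0" using m(1) pos[OF r] r2[OF r] q by simp
    then show "\<bar>u r\<bar> < 1" by (simp add: abs_square_less_1)
    show "0 < 1 - u r * r" using m(2) pos[OF r] r2[OF r] by simp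
    show "(1 - (u r)\<^sup>2) * (1 - r\<^sup>2) = (q * (1 - u r * r))\<^sup>2" using m(3) pos[OF r] by simp
  qed
  have x: "\<bar>x r\<bar> < 1" if "r \<in> {-1<..<1}" for r
    using mult_strict_mono'[of "\<bar>u r\<bar>" 1 "\<bar>r\<bar>" 1] u(1)[OF that] that
    by (auto simp: xu abs_mult abs_less_iff)
  have A: "(\<Sum>n. complex_of_real (\<alpha> n) * complex_of_real y ^ n) = complex_of_real (A y)"
    if "\<bar>y\<bar> < 1" for y
    using suminf_of_real[OF summable_bounded_power_series[of \<alpha> C y], where ?'a = complex] \<alpha> that
    by (simp add: A_def)

  show "continuous_on {-1<..<1} g"
  proof -
    have cx: "continuous_on {-1<..<1} x"
      unfolding x_def using pos by (intro continuous_intros) force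
    have "x ` {-1<..<1} \<subseteq> {-1<..<1}" using x by (force simp: abs_less_iff)
    then have "continuous_on {-1<..<1} (\<lambda>r. A (x r))"
      unfolding A_def
      by (intro continuous_on_compose2[OF continuous_on_bounded_power_series[OF \<alpha>] cx])
    then show ?thesis unfolding g by (intro continuous_intros cx)
  qed

  show "g r \<le> C" if r: "r \<in> {-1<..<1}" for r
  proof -
    \<comment> \<open>By the constraint the two sides differ by the square
      \<open>(\<bar>u r\<bar> - \<bar>r\<bar>)\<^sup>2\<close>. The resulting bound cancels the
      denominator in the estimate of the series.\<close>
    have "(q * (1 - x r))\<^sup>2 \<le> (1 - \<bar>x r\<bar>)\<^sup>2"
    proof -
      have "(1 - \<bar>x r\<bar>)\<^sup>2 - (q * (1 - x r))\<^sup>2 = (\<bar>u r\<bar> - \<bar>r\<bar>)\<^sup>2"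
        unfolding xu u(3)[OF r, symmetric] by (simp add: abs_mult power2_diff algebra_simps)
      then show ?thesis using zero_le_power2[of "\<bar>u r\<bar> - \<bar>r\<bar>"] by linarith
    qed
    then have "\<bar>q * (1 - x r)\<bar> \<le> 1 - \<bar>x r\<bar>"
      using x[OF r] by (simp add: abs_le_square_iff[symmetric])
    then have "\<bar>q * (1 - x r)\<bar> * \<bar>r\<bar> * \<bar>A (x r)\<bar> \<le> (1 - \<bar>x r\<bar>) * 1 * (C / (1 - \<bar>x r\<bar>))"
      unfolding A_def using r x[OF r] by (intro mult_mono abs_power_series_le \<alpha>) auto
    then show ?thesis using x[OF r] by (simp add: g abs_mult)
  qed

  show "?B = ?D"
  proof (intro set_eqI iffI)
    fix z assume "z \<in> ?B"
    then obtain w v where w: "norm w < 1" and v: "norm v < 1"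
      and c: "hardy_inner (normalized_kernel w) (normalized_kernel v) = complex_of_real q"
      and z: "z = hardy_inner (weighted_shift \<alpha> (normalized_kernel w)) (normalized_kernel v)"
      by (auto simp: q_berezin_range_def)
    define s where "s = sqrt (1 - (norm w)\<^sup>2) * sqrt (1 - (norm v)\<^sup>2)"
    have lt: "norm w * norm v < 1"
      using w v mult_strict_mono'[of "norm w" 1 "norm v" 1] by simp
    then have "cnj w * v \<noteq> 1"
      by (metis complex_mod_cnj norm_mult norm_one order_less_irrefl)
    then have s: "complex_of_real s = q * (1 - cnj w * v)"
      using c unfolding hardy_inner_normalized_kernels[OF w v] by (simp add: s_def field_simps)
    \<comment> \<open>The constraint solved for \<open>cnj w * v\<close>; the right-hand side is
      visibly real.\<close>
    define y where "y = 1 - s / q"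
    have y: "cnj w * v = complex_of_real y"
      using s q by (simp add: y_def field_simps)
    have sy: "s = q * (1 - y)" using q by (simp add: y_def)
    have "norm (cnj w * v) = \<bar>y\<bar>" unfolding y by simp
    then have ny: "norm w * norm v = \<bar>y\<bar>" by (simp add: norm_mult)
    have "z = s * v * A y"
      unfolding z hardy_inner_weighted_shift_normalized_kernels[OF \<alpha> w v]
      using A[of y] lt ny y by (simp add: s_def)
    then have nz: "norm z = \<bar>q * (1 - y)\<bar> * norm v * \<bar>A y\<bar>"
      by (simp only: norm_mult norm_of_real sy)
    show "z \<in> ?D"
    \<comment> \<open>At \<open>v = 0\<close> there is no direction to rotate from, but the form
      vanishes there, as does \<open>g 0\<close>.\<close>
    proof (cases "v = 0")
      case True
      then have "norm z = g 0" by (simp add: nz g)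
      then show ?thesis by auto
    next
      case False
      define r where "r = norm v"
      have r: "0 < r" "r < 1" using False v by (auto simp: r_def)
      \<comment> \<open>Rotating both points so that \<open>v\<close> becomes \<open>r\<close>
        preserves \<open>cnj w * v = y\<close>, so \<open>w\<close> becomes the real number
        \<open>y / r\<close>.\<close>
      define u0 where "u0 = y / r"
      have yu: "y = u0 * r" using r by (simp add: u0_def)
      have "\<bar>u0\<bar> = norm w" using ny r by (simp add: u0_def r_def field_simps)
      then have "u0\<^sup>2 = (norm w)\<^sup>2" by (metis power2_abs)
      moreover have "s\<^sup>2 = (1 - (norm w)\<^sup>2) * (1 - (norm v)\<^sup>2)"
        using w v by (simp add: s_def power_mult_distrib power_le_one)
      ultimately have "(1 - u0\<^sup>2) * (1 - r\<^sup>2) = (q * (1 - u0 * r))\<^sup>2"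
        using sy yu by (simp add: r_def)
      then have "u0 = (r + p) / (1 + r * p) \<or> u0 = (r - p) / (1 - r * p)"
        using r p by (intro constraint_imp_moebius[OF qp]) auto
      then show ?thesis
      proof
        assume "u0 = (r + p) / (1 + r * p)"
        then have "x r = y" by (simp add: x_def yu)
        then have "norm z = g r" using r by (simp add: nz g abs_mult r_def)
        then show ?thesis using r by auto
      next
        assume u0: "u0 = (r - p) / (1 - r * p)"
        \<comment> \<open>At \<open>- r\<close> the map with \<open>+p\<close> takes the value
          \<open>- u0\<close>: the product is unchanged, and the absolute value in \<open>g\<close>
          absorbs the sign of \<open>r\<close>.\<close>
        have "x (- r) = - (r - p) / (1 - r * p) * - r" by (simp add: x_def)
        also have "\<dots> = y" unfolding yu u0 by (simp only: minus_divide_left[symmetric] minus_mult_minus)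
        finally have "norm z = g (- r)" using r by (simp add: nz g abs_mult r_def)
        then show ?thesis using r by auto
      qed
    qed
  next
    fix z assume "z \<in> ?D"
    then obtain r where r: "r \<in> {-1<..<1}" and nz: "norm z = g r" by auto
    define b where "b = q * (1 - x r) * r * A (x r)"
    \<comment> \<open>\<open>b\<close> is the value of the form at the real pair
      \<open>(u r, r)\<close>, and \<open>c\<close> rotates it to \<open>z\<close>. If
      \<open>b = 0\<close> then \<open>z = 0\<close>, and any unimodular \<open>c\<close> would
      do.\<close>
    define c where "c = (if b = 0 then 1 else z / b)"
    have nb: "norm z = \<bar>b\<bar>" by (simp add: nz g b_def)
    then have nc: "norm c = 1" and zc: "z = c * b" by (auto simp: c_def norm_divide)
    \<comment> \<open>The common rotation cancels in \<open>cnj w * v\<close>, so the constraint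
      survives, while the single factor \<open>v\<close> in the form contributes
      \<open>c\<close>.\<close>
    define w v where "w = c * u r" and "v = c * r"
    have nw: "norm w = \<bar>u r\<bar>" and nv: "norm v = \<bar>r\<bar>"
      by (simp_all add: w_def v_def norm_mult nc)
    have w: "norm w < 1" and v: "norm v < 1" using nw nv u(1)[OF r] r by (auto simp: abs_less_iff)
    have "cnj c * c = 1" using nc by (simp add: complex_norm_square[symmetric] mult.commute)
    then have y: "cnj w * v = complex_of_real (x r)"
      by (simp add: w_def v_def xu)
    \<comment> \<open>The root of the squared constraint is \<open>q * (1 - x r)\<close> itself,
      because both factors are positive.\<close>
    have "sqrt (1 - (norm w)\<^sup>2) * sqrt (1 - (norm v)\<^sup>2) = sqrt ((q * (1 - u r * r))\<^sup>2)"
      unfolding nw nv power2_abs u(3)[OF r, symmetric] by (simp add: real_sqrt_mult)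
    also have "\<dots> = q * (1 - x r)"
      using q u(2)[OF r] by (simp add: xu)
    finally have s: "sqrt (1 - (norm w)\<^sup>2) * sqrt (1 - (norm v)\<^sup>2) = q * (1 - x r)" .
    note s = s[THEN arg_cong[of _ _ complex_of_real], unfolded of_real_mult]
    have x1: "complex_of_real (x r) \<noteq> 1" using u(2)[OF r] by (simp only: xu of_real_eq_1_iff)
    have "hardy_inner (normalized_kernel w) (normalized_kernel v) = complex_of_real q"
      unfolding hardy_inner_normalized_kernels[OF w v] of_real_mult s y
      using x1 by simp
    moreover have "hardy_inner (weighted_shift \<alpha> (normalized_kernel w)) (normalized_kernel v) = z"
      unfolding hardy_inner_weighted_shift_normalized_kernels[OF \<alpha> w v] of_real_mult s y A[OF x[OF r]]
      by (simp add: zc b_def v_def mult_ac)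
    ultimately show "z \<in> ?B"
      unfolding q_berezin_range_def mem_Collect_eq using w v
      by (intro exI[where x = w] exI[where x = v]) simp
  qed
qed

theorem theorem3p18:
  fixes q :: real and \<alpha> :: "nat \<Rightarrow> real"
  assumes "0 < q" and "q \<le> 1"
    and "bounded (range \<alpha>)"
  shows "disc_centered_at_origin (q_berezin_range q (weighted_shift \<alpha>)) \<and>
         convex (q_berezin_range q (weighted_shift \<alpha>))"
proof -
  obtain C where \<alpha>: "\<And>n. \<bar>\<alpha> n\<bar> \<le> C"
    using assms(3) by (auto simp: bounded_iff)
  note range = q_berezin_range_weighted_shift[OF assms(1,2) \<alpha>]
  have "disc_centered_at_origin (q_berezin_range q (weighted_shift \<alpha>))"
    unfolding range(1)
  proof (rule disc_centered_at_origin_norm_mem, goal_cases)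
    case 1
    show ?case by (rule connected_continuous_image[OF range(2) connected_Ioo])
  next
    case 2
    show ?case by (rule image_eqI[of _ _ 0]) auto
  next
    case 3
    show ?case using range(3) by (intro bdd_aboveI2)
  qed
  then show ?thesis by (simp add: convex_disc_centered_at_origin)
qed

end
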